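(* For every $m\ge1$ there is a bijection between the set $\widehat{\mathcal{T}}(m)$ of unordered unilabelled-bilabelled increasing trees with label set $\{1,\dots,m\}$ and the disjoint union $\widehat{\mathcal{Q}}(m)\,\dot\cup\,\widehat{\mathcal{Q}}(m-1)$, where $\widehat{\mathcal{Q}}(j)$ is the set of unordered increasing trees with $j$ nodes in which each node of out-degree at least $2$ is coloured either black or white (nodes of out-degree $0$ or $1$ being white), and $\widehat{\mathcal{Q}}(0)=\emptyset$.
   Context: An unordered unilabelled-bilabelled increasing tree with label set $\{1,\dots,m\}$ is a rooted non-plane tree in which each node carries a set of one or two labels, these sets partitioning $\{1,\dots,m\}$, such that every label of a child is larger than every label of its parent. An unordered increasing tree with $j$ nodes is a rooted non-plane tree whose nodes carry the distinct labels $1,\dots,j$ such that each child has a larger label than its parent. The out-degree of a node is its number of children. *)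

theory Defs
  imports "HOL-Library.Disjoint_Sets" "HOL-Library.FuncSet"
begin

text \<open>
  A rooted non-plane tree is given by its node set \<open>V\<close>, its root \<open>r\<close> and the set \<open>E\<close> of its
  (parent, child) pairs.
\<close>

definition rooted_tree :: "'v set \<Rightarrow> 'v \<Rightarrow> ('v \<times> 'v) set \<Rightarrow> bool" where
  "rooted_tree V r E \<longleftrightarrow>
     finite V \<and> r \<in> V \<and> E \<subseteq> V \<times> V \<and>
     (\<forall>u. (u, r) \<notin> E) \<and>
     (\<forall>v\<in>V - {r}. \<exists>!u. (u, v) \<in> E) \<and>
     (\<forall>v\<in>V. (r, v) \<in> E\<^sup>*)"

definition out_degree :: "('v \<times> 'v) set \<Rightarrow> 'v \<Rightarrow> nat" where
  "out_degree E v = card (E `` {v})"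

text \<open>
  Since all labels are distinct, a labelled tree has no symmetries, and a node is identified with
  what it carries: with its set of labels here, with its label in \<open>coloured_trees\<close> below.
  Hence the elements of these sets are the labelled trees themselves, with no further
  identification up to isomorphism.
\<close>

definition uni_bilabelled_trees ::
    "nat \<Rightarrow> (nat set set \<times> nat set \<times> (nat set \<times> nat set) set) set" where
  "uni_bilabelled_trees m =
     {(P, R, E). partition_on {1..m} P \<and> (\<forall>A\<in>P. card A = 1 \<or> card A = 2) \<and>
        rooted_tree P R E \<and>
        (\<forall>(A, B)\<in>E. \<forall>a\<in>A. \<forall>b\<in>B. a < b)}"

definition increasing_trees :: "nat \<Rightarrow> (nat \<times> (nat \<times> nat) set) set" where
  "increasing_trees j = {(r, E). rooted_tree {1..j} r E \<and> (\<forall>(u, v)\<in>E. u < v)}"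

datatype colour = Black | White

definition coloured_trees :: "nat \<Rightarrow> ((nat \<times> (nat \<times> nat) set) \<times> (nat \<Rightarrow> colour)) set" where
  "coloured_trees j =
     {((r, E), c). (r, E) \<in> increasing_trees j \<and> c \<in> {1..j} \<rightarrow>\<^sub>E UNIV \<and>
        (\<forall>v\<in>{1..j}. out_degree E v < 2 \<longrightarrow> c v = White)}"

lemma coloured_trees_0: "coloured_trees 0 = {}"
  by (auto simp: coloured_trees_def increasing_trees_def rooted_tree_def)

end

theory Submission
  imports Defs
begin

text \<open>
  Both sides are finite, so it suffices to count. Removing the largest label turns both families
  into generating trees. A unilabelled-bilabelled tree grows by hanging a new node \<open>{m + 1}\<close>
  below any node, or by adding \<open>m + 1\<close> to a unilabelled leaf; marking unilabelled leaves by \<open>y\<close> and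
  all other nodes by \<open>x\<close>, this is the derivation \<open>D x = x y\<close>, \<open>D y = x y + x\<close>, applied \<open>m - 1\<close> times
  to \<open>y\<close>. A coloured tree grows by hanging a new leaf below any node; marking nodes of out-degree
  0, 1 and at least 2 by \<open>u\<close>, \<open>v\<close>, \<open>w\<close>, this is the derivation \<open>D u = u v\<close>, \<open>D v = 2 u w\<close>,
  \<open>D w = u w\<close>, applied \<open>m - 1\<close> times to \<open>u\<close>. Since \<open>D (v + 1 - 2 w) = 0\<close> and \<open>v + 1 = 2 w\<close> at
  \<open>u = v = w = 1\<close>, one may replace \<open>2 w\<close> by \<open>v + 1\<close>, and then \<open>x = u\<close>, \<open>y = v\<close> identifies the two
  derivations. Finally \<open>D y = D x + x\<close> yields the two summands \<open>m\<close> and \<open>m - 1\<close>.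
\<close>

section \<open>Rooted trees\<close>

lemma rooted_tree_add_leaf:
  assumes "rooted_tree V r E" "p \<in> V" "v \<notin> V"
  shows "rooted_tree (insert v V) r (insert (p, v) E)"
proof -
  have mono: "E\<^sup>* \<subseteq> (insert (p, v) E)\<^sup>*"
    by (rule rtrancl_mono) auto
  have "(r, p) \<in> (insert (p, v) E)\<^sup>*"
    using assms mono by (auto simp: rooted_tree_def)
  then have "(r, v) \<in> (insert (p, v) E)\<^sup>*"
    by (rule rtrancl_into_rtrancl) simp
  moreover have "\<exists>!u. (u, w) \<in> insert (p, v) E" if "w \<in> insert v V - {r}" for w
  proof (cases "w = v")
    case True
    then show ?thesis using assms by (auto simp: rooted_tree_def)
  next
    case False
    then show ?thesis using assms that by (simp add: rooted_tree_def)
  qed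
  ultimately show ?thesis
    using assms mono by (auto simp: rooted_tree_def)
qed

text \<open>Inverse to \<open>rooted_tree_add_leaf\<close>: \<open>v\<close> has one incoming edge
  and no outgoing one, so deleting it disconnects nothing else.\<close>

lemma rooted_tree_remove_leaf:
  assumes "rooted_tree V r E" "v \<in> V" "v \<noteq> r" "v \<notin> Domain E"
  obtains p E' where "p \<in> V - {v}" "E = insert (p, v) E'" "rooted_tree (V - {v}) r E'"
proof -
  define E' where "E' = {e \<in> E. snd e \<noteq> v}"
  have "\<exists>!u. (u, v) \<in> E"
    using assms by (auto simp: rooted_tree_def)
  then obtain p where p: "(p, v) \<in> E" "\<And>u. (u, v) \<in> E \<Longrightarrow> u = p"
    by blast
  have E: "E = insert (p, v) E'"
  proof (intro equalityI subsetI)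
    fix e assume "e \<in> E"
    then show "e \<in> insert (p, v) E'"
      using p(2)[of "fst e"] by (cases "snd e = v") (auto simp: E'_def)
  qed (use p(1) in \<open>auto simp: E'_def\<close>)
  have sub: "E \<subseteq> V \<times> V"
    using assms(1) unfolding rooted_tree_def by blast
  \<comment> \<open>The restriction \<open>w \<noteq> v\<close> lets the induction run along every
    path; an inner node \<open>y\<close> has an outgoing edge and hence differs from
    \<open>v\<close>.\<close>
  have reach: "w \<noteq> v \<longrightarrow> (r, w) \<in> E'\<^sup>*" if "(r, w) \<in> E\<^sup>*" for w
    using that
  proof (induction rule: rtrancl_induct)
    case base
    then show ?case by simp
  next
    case (step y z)
    have "y \<noteq> v"
      using step assms by blast
    moreover have "z \<noteq> v \<Longrightarrow> (y, z) \<in> E'"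
      using step by (simp add: E'_def)
    ultimately show ?case
      using step by (meson rtrancl.rtrancl_into_rtrancl)
  qed
  have "\<exists>!u. (u, w) \<in> E'" if "w \<in> V - {v} - {r}" for w
    using assms that by (auto simp: rooted_tree_def E'_def)
  moreover have "E' \<subseteq> (V - {v}) \<times> (V - {v})"
    using sub assms by (auto simp: E'_def)
  ultimately have "rooted_tree (V - {v}) r E'"
    using assms reach by (auto simp: rooted_tree_def E'_def)
  moreover have "p \<in> V - {v}"
    using p sub assms by blast
  ultimately show ?thesis
    using that E by blast
qed

text \<open>Where nodes are label sets, enlarging one set renames a node throughout the tree.
  Injectivity on \<open>V\<close> lets each edge of the image be pulled back to a single
  edge.\<close>

lemma rooted_tree_relabel:
  assumes "rooted_tree V r E" "inj_on g V"
  shows "rooted_tree (g ` V) (g r) (map_prod g g ` E)"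
proof -
  have sub: "E \<subseteq> V \<times> V" and r: "r \<in> V"
    using assms by (auto simp: rooted_tree_def)
  have edge: "(g u, g v) \<in> map_prod g g ` E \<longleftrightarrow> (u, v) \<in> E" if "u \<in> V" "v \<in> V" for u v
  proof
    assume "(g u, g v) \<in> map_prod g g ` E"
    then obtain u' v' where "(u', v') \<in> E" "g u = g u'" "g v = g v'"
      by auto
    moreover from this have "u = u'" "v = v'"
      using assms(2) sub that by (auto dest: inj_onD)
    ultimately show "(u, v) \<in> E"
      by simp
  next
    assume "(u, v) \<in> E"
    then show "(g u, g v) \<in> map_prod g g ` E"
      by (intro image_eqI[of _ _ "(u, v)"]) simp_all
  qed
  have source: "\<exists>u \<in> V. x = g u" if "(x, y) \<in> map_prod g g ` E" for x y
    using that sub by auto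
  have "(x, g r) \<notin> map_prod g g ` E" for x
    using edge r source assms(1) unfolding rooted_tree_def by metis
  moreover have parent: "\<exists>!x. (x, g v) \<in> map_prod g g ` E" if "v \<in> V" "v \<noteq> r" for v
  proof -
    have "\<exists>!u. (u, v) \<in> E"
      using assms(1) that by (auto simp: rooted_tree_def)
    then obtain u where u: "(u, v) \<in> E" "\<And>w. (w, v) \<in> E \<Longrightarrow> w = u"
      by blast
    show ?thesis
    proof
      show "(g u, g v) \<in> map_prod g g ` E"
        using u(1) by (intro image_eqI[of _ _ "(u, v)"]) simp_all
      show "x = g u" if x: "(x, g v) \<in> map_prod g g ` E" for x
      proof -
        obtain w where w: "w \<in> V" "x = g w"
          using source[OF x] by blast
        then have "(w, v) \<in> E"
          using x edge[OF w(1) \<open>v \<in> V\<close>] by simp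
        then show ?thesis
          using u(2) w(2) by simp
      qed
    qed
  qed
  have "\<forall>x \<in> g ` V - {g r}. \<exists>!y. (y, x) \<in> map_prod g g ` E"
  proof
    fix x assume "x \<in> g ` V - {g r}"
    then obtain v where "v \<in> V" "v \<noteq> r" "x = g v"
      by blast
    then show "\<exists>!y. (y, x) \<in> map_prod g g ` E"
      using parent[of v] by simp
  qed
  moreover have "(g r, g v) \<in> (map_prod g g ` E)\<^sup>*" if "(r, v) \<in> E\<^sup>*" for v
    using that by induction (auto intro: rtrancl_into_rtrancl)
  then have "\<forall>x \<in> g ` V. (g r, x) \<in> (map_prod g g ` E)\<^sup>*"
    using assms(1) by (auto simp: rooted_tree_def)
  moreover have "finite V" "map_prod g g ` E \<subseteq> g ` V \<times> g ` V"
    using assms(1) sub by (auto simp: rooted_tree_def)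
  ultimately show ?thesis
    using r by (simp add: rooted_tree_def)
qed

text \<open>A nontrivial path from \<open>r\<close> would need an edge out of \<open>r\<close>.
  Consequently the childless node with the largest label can be the root only in a one-node
  tree.\<close>

lemma rooted_tree_root_leaf:
  assumes "rooted_tree V r E" "r \<notin> Domain E"
  shows "V = {r}"
proof -
  have "v = r" if "(r, v) \<in> E\<^sup>*" for v
    using that assms(2) by (metis Domain.DomainI converse_rtranclE)
  then show ?thesis
    using assms by (auto simp: rooted_tree_def)
qed

section \<open>Growth of increasing trees\<close>

lemma finite_increasing_trees: "finite (increasing_trees j)"
proof (rule finite_subset)
  show "increasing_trees j \<subseteq> {1..j} \<times> Pow ({1..j} \<times> {1..j})"
    by (auto simp: increasing_trees_def rooted_tree_def)
qed simp

lemma increasing_trees_1: "increasing_trees 1 = {(1, {})}"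
  by (auto simp: increasing_trees_def rooted_tree_def)

text \<open>The largest label sits on a leaf, since a child would need a larger one; removing that
  leaf and remembering its parent loses nothing.\<close>

lemma bij_betw_increasing_trees_Suc:
  assumes "j \<ge> 1"
  shows "bij_betw (\<lambda>((r, E), v). (r, insert (v, Suc j) E))
           (increasing_trees j \<times> {1..j}) (increasing_trees (Suc j))"
proof (rule bij_betw_imageI)
  let ?f = "\<lambda>((r, E), v). (r, insert (v, Suc j) E)"
  have sub: "E \<subseteq> {1..j} \<times> {1..j}" if "(r, E) \<in> increasing_trees j" for r E
    using that by (simp add: increasing_trees_def rooted_tree_def)
  show "inj_on ?f (increasing_trees j \<times> {1..j})"
  proof (rule inj_onI, clarsimp)
    fix r E v E' v'
    assume E: "(r, E) \<in> increasing_trees j" and E': "(r, E') \<in> increasing_trees j"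
      and eq: "insert (v, Suc j) E = insert (v', Suc j) E'"
    have no: "(u, Suc j) \<notin> E" "(u, Suc j) \<notin> E'" for u
      using sub[OF E] sub[OF E'] by auto
    then have "v = v'"
      using eq by blast
    then show "E = E' \<and> v = v'"
      using eq no by (simp add: insert_ident)
  qed
  have V: "{1..Suc j} = insert (Suc j) {1..j}" "{1..Suc j} - {Suc j} = {1..j}"
    by auto
  show "?f ` (increasing_trees j \<times> {1..j}) = increasing_trees (Suc j)"
  proof (intro equalityI subsetI)
    fix t assume "t \<in> ?f ` (increasing_trees j \<times> {1..j})"
    then obtain r E v where t: "t = (r, insert (v, Suc j) E)"
      and E: "rooted_tree {1..j} r E" "\<forall>(u, v)\<in>E. u < v" and v: "v \<in> {1..j}"
      by (auto simp: increasing_trees_def)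
    then show "t \<in> increasing_trees (Suc j)"
      using rooted_tree_add_leaf[OF E(1) v, of "Suc j"] unfolding increasing_trees_def V by auto
  next
    fix t assume "t \<in> increasing_trees (Suc j)"
    then obtain r E where t: "t = (r, E)"
      and E: "rooted_tree {1..Suc j} r E" "\<forall>(u, v)\<in>E. u < v"
      by (auto simp: increasing_trees_def)
    have leaf: "Suc j \<notin> Domain E"
      using E by (force simp: rooted_tree_def)
    \<comment> \<open>A childless root would be the only node, but \<open>j \<ge> 1\<close> provides
      the node 1 besides \<open>Suc j\<close>.\<close>
    have "Suc j \<noteq> r"
    proof
      assume r: "Suc j = r"
      then have "{1..Suc j} = {r}"
        using rooted_tree_root_leaf[OF E(1)] leaf by blast
      moreover have "1 \<in> {1..Suc j}"
        by simp
      ultimately show False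
        using r assms by auto
    qed
    then obtain p E' where p: "p \<in> {1..j}" "E = insert (p, Suc j) E'" "rooted_tree {1..j} r E'"
      using rooted_tree_remove_leaf[OF E(1) _ _ leaf] unfolding V(2) by auto
    then have "(r, E') \<in> increasing_trees j"
      using E(2) by (simp add: increasing_trees_def)
    then show "t \<in> ?f ` (increasing_trees j \<times> {1..j})"
      using p t by (intro image_eqI[of _ _ "((r, E'), p)"]) simp_all
  qed
qed

section \<open>Out-degree classes and the effect of a new leaf on them\<close>

definition leaves :: "nat \<Rightarrow> (nat \<times> nat) set \<Rightarrow> nat set" where
  "leaves j E = {v \<in> {1..j}. out_degree E v = 0}"

definition unary_nodes :: "nat \<Rightarrow> (nat \<times> nat) set \<Rightarrow> nat set" where
  "unary_nodes j E = {v \<in> {1..j}. out_degree E v = 1}"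

definition branching_nodes :: "nat \<Rightarrow> (nat \<times> nat) set \<Rightarrow> nat set" where
  "branching_nodes j E = {v \<in> {1..j}. out_degree E v \<ge> 2}"

lemmas degree_class_defs = leaves_def unary_nodes_def branching_nodes_def

lemma finite_degree_classes [simp]:
  "finite (leaves j E)" "finite (unary_nodes j E)" "finite (branching_nodes j E)"
  by (simp_all add: degree_class_defs)

lemma out_degree_add_leaf:
  assumes "E \<subseteq> {1..j} \<times> {1..j}"
  shows "out_degree (insert (v, Suc j) E) w = out_degree E w + (if w = v then 1 else 0)"
proof -
  have "finite E"
    using assms finite_subset by blast
  then have "finite (E `` {v})"
    by (rule finite_Image)
  moreover have "insert (v, Suc j) E `` {w} = (if w = v then insert (Suc j) (E `` {v}) else E `` {w})"
    by auto
  moreover have "Suc j \<notin> E `` {v}"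
    using assms by auto
  ultimately show ?thesis
    by (simp add: out_degree_def)
qed

text \<open>The new node is a leaf, and its parent moves from leaf to unary or from unary to
  branching, or stays branching; one product for each case. For general \<open>\<phi>\<close> the
  right side is the derivation acting on the weight, as the later induction needs.\<close>

lemma sum_increasing_trees_Suc:
  fixes \<phi> :: "nat \<Rightarrow> nat \<Rightarrow> nat \<Rightarrow> nat"
  assumes "j \<ge> 1"
  shows "(\<Sum>(r, E)\<in>increasing_trees (Suc j).
            \<phi> (card (leaves (Suc j) E)) (card (unary_nodes (Suc j) E)) (card (branching_nodes (Suc j) E)))
       = (\<Sum>(r, E)\<in>increasing_trees j.
            let p = card (leaves j E); q = card (unary_nodes j E); b = card (branching_nodes j E)
            in p * \<phi> p (q + 1) b + q * \<phi> (p + 1) (q - 1) (b + 1) + b * \<phi> (p + 1) q b)"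
    (is "?lhs = ?rhs")
proof -
  let ?\<phi> = "\<lambda>j E. \<phi> (card (leaves j E)) (card (unary_nodes j E)) (card (branching_nodes j E))"
  have "?lhs = (\<Sum>((r, E), v)\<in>increasing_trees j \<times> {1..j}. ?\<phi> (Suc j) (insert (v, Suc j) E))"
    by (subst sum.reindex_bij_betw[OF bij_betw_increasing_trees_Suc[OF assms], symmetric])
       (simp add: case_prod_beta)
  also have "\<dots> = (\<Sum>(r, E)\<in>increasing_trees j. \<Sum>v\<in>{1..j}. ?\<phi> (Suc j) (insert (v, Suc j) E))"
    by (simp add: sum.cartesian_product case_prod_beta)
  also have "\<dots> = ?rhs"
  proof (rule sum.cong[OF refl], clarify)
    fix r E assume "(r, E) \<in> increasing_trees j"
    then have sub: "E \<subseteq> {1..j} \<times> {1..j}"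
      by (simp add: increasing_trees_def rooted_tree_def)
    let ?L = "leaves j E" and ?U = "unary_nodes j E" and ?B = "branching_nodes j E"
    let ?E = "\<lambda>v. insert (v, Suc j) E"
    have "E `` {Suc j} = {}"
      using sub by auto
    then have new: "out_degree E (Suc j) = 0"
      by (simp add: out_degree_def)
    note deg = out_degree_add_leaf[OF sub]
    have notin: "Suc j \<notin> ?L" "Suc j \<notin> ?U" "Suc j \<notin> ?B"
      by (auto simp: degree_class_defs)
    have L: "?\<phi> (Suc j) (?E v) = \<phi> (card ?L) (card ?U + 1) (card ?B)" if v: "v \<in> ?L" for v
    proof -
      have "leaves (Suc j) (?E v) = insert (Suc j) (?L - {v})"
        "unary_nodes (Suc j) (?E v) = insert v ?U" "branching_nodes (Suc j) (?E v) = ?B"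
        using v new by (auto simp: degree_class_defs deg le_Suc_eq split: if_splits)
      \<comment> \<open>Positivity matters because the new leaf count arises as
        \<open>card ?L - 1 + 1\<close> with truncated subtraction.\<close>
      moreover have "v \<notin> ?U" "card ?L > 0"
        using v by (auto simp: degree_class_defs card_gt_0_iff)
      ultimately show ?thesis
        using v notin by (simp add: card_Diff_singleton)
    qed
    have U: "?\<phi> (Suc j) (?E v) = \<phi> (card ?L + 1) (card ?U - 1) (card ?B + 1)" if v: "v \<in> ?U" for v
    proof -
      have "leaves (Suc j) (?E v) = insert (Suc j) ?L"
        "unary_nodes (Suc j) (?E v) = ?U - {v}" "branching_nodes (Suc j) (?E v) = insert v ?B"
        using v new by (auto simp: degree_class_defs deg le_Suc_eq split: if_splits)
      moreover have "v \<notin> ?B"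
        using v by (auto simp: degree_class_defs)
      ultimately show ?thesis
        using v notin by (simp add: card_Diff_singleton)
    qed
    have B: "?\<phi> (Suc j) (?E v) = \<phi> (card ?L + 1) (card ?U) (card ?B)" if v: "v \<in> ?B" for v
    proof -
      have "leaves (Suc j) (?E v) = insert (Suc j) ?L"
        "unary_nodes (Suc j) (?E v) = ?U" "branching_nodes (Suc j) (?E v) = ?B"
        using v new by (auto simp: degree_class_defs deg le_Suc_eq split: if_splits)
      then show ?thesis
        using notin by simp
    qed
    have "{1..j} = ?L \<union> ?U \<union> ?B" "(?L \<union> ?U) \<inter> ?B = {}" "?L \<inter> ?U = {}"
      by (auto simp: degree_class_defs)
    then have "(\<Sum>v\<in>{1..j}. ?\<phi> (Suc j) (?E v)) =
        (\<Sum>v\<in>?L. ?\<phi> (Suc j) (?E v)) + (\<Sum>v\<in>?U. ?\<phi> (Suc j) (?E v)) + (\<Sum>v\<in>?B. ?\<phi> (Suc j) (?E v))"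
      by (simp add: sum.union_disjoint)
    also have "\<dots> = card ?L * \<phi> (card ?L) (card ?U + 1) (card ?B)
        + card ?U * \<phi> (card ?L + 1) (card ?U - 1) (card ?B + 1)
        + card ?B * \<phi> (card ?L + 1) (card ?U) (card ?B)"
      using L U B by simp
    finally show "(\<Sum>v\<in>{1..j}. ?\<phi> (Suc j) (?E v)) =
        (let p = card ?L; q = card ?U; b = card ?B
         in p * \<phi> p (q + 1) b + q * \<phi> (p + 1) (q - 1) (b + 1) + b * \<phi> (p + 1) q b)"
      by (simp add: Let_def)
  qed
  finally show ?thesis .
qed

text \<open>Over a fixed tree the colourings form a product over the nodes, with one choice below
  out-degree 2 and two choices from there on.\<close>

lemma
  shows finite_coloured_trees: "finite (coloured_trees j)"
    and card_coloured_trees: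
      "card (coloured_trees j) = (\<Sum>(r, E)\<in>increasing_trees j. 2 ^ card (branching_nodes j E))"
proof -
  define C where "C E = (\<Pi>\<^sub>E v\<in>{1..j}. if out_degree E v < 2 then {White} else UNIV)"
    for E :: "(nat \<times> nat) set"
  have UNIV_colour: "UNIV = {Black, White}"
  proof (intro equalityI subsetI)
    show "c \<in> {Black, White}" for c :: colour
      by (cases c) simp_all
  qed simp
  have fin: "finite (C E)" for E
    unfolding C_def by (rule finite_PiE) (simp_all add: UNIV_colour)
  have eq: "coloured_trees j = Sigma (increasing_trees j) (\<lambda>t. C (snd t))"
  proof -
    have "c \<in> C E \<longleftrightarrow> c \<in> {1..j} \<rightarrow>\<^sub>E UNIV \<and> (\<forall>v\<in>{1..j}. out_degree E v < 2 \<longrightarrow> c v = White)"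
      for c E
      unfolding C_def PiE_iff by (auto split: if_splits)
    then show ?thesis
      unfolding coloured_trees_def by auto
  qed
  show "finite (coloured_trees j)"
    unfolding eq using fin finite_increasing_trees by auto
  have "card (C E) = 2 ^ card (branching_nodes j E)" for E
  proof -
    have "card (C E) = (\<Prod>v\<in>{1..j}. if out_degree E v < 2 then 1 else 2)"
      unfolding C_def by (subst card_PiE) (auto intro!: prod.cong simp: UNIV_colour)
    also have "\<dots> = (\<Prod>v\<in>branching_nodes j E. 2)"
      by (rule prod.mono_neutral_cong_right) (auto simp: branching_nodes_def)
    finally show ?thesis
      by simp
  qed
  then show "card (coloured_trees j) = (\<Sum>(r, E)\<in>increasing_trees j. 2 ^ card (branching_nodes j E))"
    unfolding eq using fin finite_increasing_trees by (simp add: case_prod_beta)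
qed

section \<open>Growth of unilabelled-bilabelled trees\<close>

text \<open>Exactly the nodes that can receive a new largest label: labels of a parent must stay
  below those of its children, and a node with two labels is full. They are the nodes marked
  \<open>y\<close>.\<close>

definition unilabelled_leaves :: "nat set set \<Rightarrow> (nat set \<times> nat set) set \<Rightarrow> nat set set" where
  "unilabelled_leaves P E = {A \<in> P. card A = 1 \<and> A \<notin> Domain E}"

definition add_singleton where
  "add_singleton n = (\<lambda>((P, R, E), A). (insert {n} P, R, insert (A, {n}) E))"

text \<open>The renaming of nodes caused by giving \<open>A\<close> the extra label
  \<open>n\<close>; \<open>merge_label\<close> applies it to blocks, root and edges alike.\<close>

definition merge :: "'a \<Rightarrow> 'a set \<Rightarrow> 'a set \<Rightarrow> 'a set" where
  "merge n A B = (if B = A then insert n A else B)"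

definition merge_label where
  "merge_label n = (\<lambda>((P, R, E), A).
     (merge n A ` P, merge n A R, map_prod (merge n A) (merge n A) ` E))"

lemma uni_bilabelled_treesD:
  assumes "(P, R, E) \<in> uni_bilabelled_trees m"
  shows "partition_on {1..m} P" "\<And>A. A \<in> P \<Longrightarrow> card A = 1 \<or> card A = 2" "rooted_tree P R E"
    "\<And>A B a b. (A, B) \<in> E \<Longrightarrow> a \<in> A \<Longrightarrow> b \<in> B \<Longrightarrow> a < b"
    "E \<subseteq> P \<times> P" "R \<in> P" "finite P" "\<Union>P = {1..m}" "\<And>A. A \<in> P \<Longrightarrow> Suc m \<notin> A"
    "\<And>A a. A \<in> P \<Longrightarrow> a \<in> A \<Longrightarrow> a \<le> m"
proof -
  have *: "partition_on {1..m} P" "rooted_tree P R E"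
    using assms by (simp_all add: uni_bilabelled_trees_def)
  show "partition_on {1..m} P" "rooted_tree P R E"
    by fact+
  show "\<And>A. A \<in> P \<Longrightarrow> card A = 1 \<or> card A = 2"
    "\<And>A B a b. (A, B) \<in> E \<Longrightarrow> a \<in> A \<Longrightarrow> b \<in> B \<Longrightarrow> a < b"
    using assms by (auto simp: uni_bilabelled_trees_def)
  show "E \<subseteq> P \<times> P" "R \<in> P" "finite P"
    using * by (auto simp: rooted_tree_def)
  show U: "\<Union>P = {1..m}"
    using * by (simp add: partition_on_def)
  show le: "a \<le> m" if "A \<in> P" "a \<in> A" for A a
  proof -
    have "a \<in> \<Union>P"
      using that by blast
    then show ?thesis
      using U by simp
  qed
  show "Suc m \<notin> A" if "A \<in> P" for A
    using le[OF that, of "Suc m"] by auto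
qed

lemma finite_uni_bilabelled_trees: "finite (uni_bilabelled_trees m)"
proof (rule finite_subset)
  let ?S = "Pow {1..m}"
  show "uni_bilabelled_trees m \<subseteq> Pow ?S \<times> ?S \<times> Pow (?S \<times> ?S)"
  proof
    fix t assume "t \<in> uni_bilabelled_trees m"
    moreover obtain P R E where t_eq: "t = (P, R, E)"
      by (rule prod_cases3)
    ultimately have t: "(P, R, E) \<in> uni_bilabelled_trees m"
      by simp
    note D = uni_bilabelled_treesD[OF t]
    have P: "P \<subseteq> ?S"
      using D(8) by blast
    then have "E \<subseteq> ?S \<times> ?S"
      using D(5) by blast
    then show "t \<in> Pow ?S \<times> ?S \<times> Pow (?S \<times> ?S)"
      using P D(6) t_eq by blast
  qed
qed simp

lemma uni_bilabelled_trees_1: "uni_bilabelled_trees 1 = {({{1}}, {1}, {})}"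
proof (intro equalityI subsetI)
  fix t assume "t \<in> uni_bilabelled_trees 1"
  then obtain P R E where t: "t = (P, R, E)" and tree: "(P, R, E) \<in> uni_bilabelled_trees 1"
    by (cases t) auto
  note D = uni_bilabelled_treesD[OF tree]
  have "A = {1}" if "A \<in> P" for A
  proof -
    have "A \<noteq> {}" "A \<subseteq> {1}"
      using that D(1) by (auto simp: partition_on_def)
    then show ?thesis
      by blast
  qed
  then have P: "P = {{1}}"
    using D(6) by blast
  \<comment> \<open>With \<open>{1}\<close> as the only block, an edge could only be a loop,
    requiring \<open>1 < 1\<close>.\<close>
  have "e \<notin> E" for e
    using D(4)[of "{1}" "{1}" 1 1] D(5) P by auto
  then show "t \<in> {({{1}}, {1}, {})}"
    using D(6) P t by auto
qed (auto simp: uni_bilabelled_trees_def partition_on_def rooted_tree_def disjoint_def)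

text \<open>A child of \<open>A\<close> would be a nonempty block whose labels all exceed
  \<open>m\<close>.\<close>

lemma max_label_leaf:
  assumes "(P, R, E) \<in> uni_bilabelled_trees m" "m \<in> A"
  shows "A \<notin> Domain E"
proof
  assume "A \<in> Domain E"
  then obtain B where B: "(A, B) \<in> E"
    by blast
  note D = uni_bilabelled_treesD[OF assms(1)]
  have "B \<in> P"
    using B D(5) by blast
  moreover from this have "B \<noteq> {}"
    using D(1) by (auto simp: partition_on_def)
  ultimately obtain b where "b \<in> B" "b \<le> m"
    using D(10) by blast
  then show False
    using D(4)[OF B assms(2), of b] by simp
qed

section \<open>Growth by a new unilabelled leaf\<close>

lemma add_singleton_in_trees:
  assumes t: "(P, R, E) \<in> uni_bilabelled_trees m" and A: "A \<in> P"
  shows "add_singleton (Suc m) ((P, R, E), A) \<in> uni_bilabelled_trees (Suc m)"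
proof -
  note D = uni_bilabelled_treesD[OF t]
  have "partition_on {1..Suc m} (insert {Suc m} P)"
    using D(1,9) by (auto simp: partition_on_def disjoint_def)
  moreover have "rooted_tree (insert {Suc m} P) R (insert (A, {Suc m}) E)"
    using rooted_tree_add_leaf[OF D(3) A] D(9) by blast
  moreover have "a < Suc m" if "a \<in> A" for a
    using D(10)[OF A that] by simp
  ultimately show ?thesis
    using D(2,4) by (auto simp: add_singleton_def uni_bilabelled_trees_def)
qed

text \<open>The node \<open>{Suc m}\<close> is a leaf, so it can be deleted, and its parent
  \<open>A\<close> records where to reattach it. With \<open>m \<ge> 1\<close> it is never the
  root.\<close>

lemma bij_betw_add_singleton:
  assumes "m \<ge> 1"
  shows "bij_betw (add_singleton (Suc m)) (Sigma (uni_bilabelled_trees m) fst)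
           {t \<in> uni_bilabelled_trees (Suc m). {Suc m} \<in> fst t}"
proof (rule bij_betw_imageI)
  show "inj_on (add_singleton (Suc m)) (Sigma (uni_bilabelled_trees m) fst)"
  proof (rule inj_onI, clarsimp simp: add_singleton_def)
    fix P R E A P' E' A'
    assume t: "(P, R, E) \<in> uni_bilabelled_trees m" "(P', R, E') \<in> uni_bilabelled_trees m"
      and eq: "insert {Suc m} P = insert {Suc m} P'"
        "insert (A, {Suc m}) E = insert (A', {Suc m}) E'"
    have no: "{Suc m} \<notin> P" "{Suc m} \<notin> P'"
      using uni_bilabelled_treesD(9)[OF t(1)] uni_bilabelled_treesD(9)[OF t(2)] by blast+
    then have noE: "(B, {Suc m}) \<notin> E" "(B, {Suc m}) \<notin> E'" for B
      using uni_bilabelled_treesD(5)[OF t(1)] uni_bilabelled_treesD(5)[OF t(2)] by blast+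
    then have "A = A'"
      using eq(2) by blast
    then show "P = P' \<and> E = E' \<and> A = A'"
      using eq no noE by (simp add: insert_ident)
  qed
  show "add_singleton (Suc m) ` Sigma (uni_bilabelled_trees m) fst
      = {t \<in> uni_bilabelled_trees (Suc m). {Suc m} \<in> fst t}" (is "?L = ?R")
  proof (intro equalityI subsetI)
    fix t assume "t \<in> ?L"
    then show "t \<in> ?R"
      using add_singleton_in_trees by (auto simp: add_singleton_def)
  next
    fix t assume "t \<in> ?R"
    then obtain P R E where t: "t = (P, R, E)" and tree: "(P, R, E) \<in> uni_bilabelled_trees (Suc m)"
      and N: "{Suc m} \<in> P"
      by (cases t) auto
    note D = uni_bilabelled_treesD[OF tree]
    have leaf: "{Suc m} \<notin> Domain E"
      using max_label_leaf[OF tree] by blast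
    have "{Suc m} \<noteq> R"
    proof
      assume "{Suc m} = R"
      then have "P = {{Suc m}}"
        using rooted_tree_root_leaf[OF D(3)] leaf by blast
      then have "{1..Suc m} = {Suc m}"
        using D(8) by simp
      then have "1 \<in> {Suc m}"
        by (metis One_nat_def Suc_leI atLeastAtMost_iff le_refl zero_less_Suc)
      then show False
        using assms by simp
    qed
    then obtain A E' where A: "A \<in> P - {{Suc m}}" "E = insert (A, {Suc m}) E'"
        "rooted_tree (P - {{Suc m}}) R E'"
      using rooted_tree_remove_leaf[OF D(3) N _ leaf] by blast
    have disj: "Suc m \<notin> B" if "B \<in> P - {{Suc m}}" for B
    proof -
      have "disjoint P" "B \<in> P" "B \<noteq> {Suc m}"
        using that D(1) by (simp_all add: partition_on_def)
      then have "B \<inter> {Suc m} = {}"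
        using N by (meson disjointD)
      then show ?thesis
        by simp
    qed
    have "\<Union>(P - {{Suc m}}) = {1..Suc m} - {Suc m}"
      using D(8) disj by blast
    then have "partition_on {1..m} (P - {{Suc m}})"
      using D(1) by (auto simp: partition_on_def disjoint_def)
    moreover have "\<forall>(A, B)\<in>E'. \<forall>a\<in>A. \<forall>b\<in>B. a < b"
      using tree A(2) by (simp add: uni_bilabelled_trees_def)
    ultimately have "(P - {{Suc m}}, R, E') \<in> uni_bilabelled_trees m"
      using A(3) D(2) by (simp add: uni_bilabelled_trees_def)
    moreover have "t = add_singleton (Suc m) ((P - {{Suc m}}, R, E'), A)"
      using N A(2) t by (simp add: add_singleton_def insert_absorb)
    ultimately show "t \<in> ?L"
      using A(1) by (intro image_eqI[of _ _ "((P - {{Suc m}}, R, E'), A)"]) simp_all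
  qed
qed

section \<open>Growth by a second label on a unilabelled leaf\<close>

lemma merge_facts:
  assumes t: "(P, R, E) \<in> uni_bilabelled_trees m" and A: "A \<in> P"
  shows "\<And>B. B \<in> P \<Longrightarrow> merge (Suc m) A B - {Suc m} = B"
    "inj_on (merge (Suc m) A) P"
    "\<And>B. B \<in> P \<Longrightarrow> Suc m \<in> merge (Suc m) A B \<longleftrightarrow> B = A"
proof -
  \<comment> \<open>No old block contains \<open>Suc m\<close>, so deleting that label undoes the
    renaming; this left inverse also gives injectivity.\<close>
  show 1: "merge (Suc m) A B - {Suc m} = B" if "B \<in> P" for B
    using uni_bilabelled_treesD(9)[OF t that] by (auto simp: merge_def)
  then show "inj_on (merge (Suc m) A) P"
    by (metis inj_onI)
  show "Suc m \<in> merge (Suc m) A B \<longleftrightarrow> B = A" if "B \<in> P" for B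
    using uni_bilabelled_treesD(9)[OF t that] by (auto simp: merge_def)
qed

text \<open>The order survives because \<open>A\<close> is childless: \<open>Suc m\<close> enters
  only at the lower end of an edge. The second claim separates these trees from those of the other
  kind of growth.\<close>

lemma merge_label_in_trees:
  assumes t: "(P, R, E) \<in> uni_bilabelled_trees m" and A: "A \<in> unilabelled_leaves P E"
  shows "merge_label (Suc m) ((P, R, E), A) \<in> uni_bilabelled_trees (Suc m)"
    "{Suc m} \<notin> merge (Suc m) A ` P"
proof -
  note D = uni_bilabelled_treesD[OF t]
  have A': "A \<in> P" "card A = 1" "A \<notin> Domain E"
    using A by (auto simp: unilabelled_leaves_def)
  let ?g = "merge (Suc m) A"
  note M = merge_facts[OF t A'(1)]
  have ne: "B \<noteq> {}" if "B \<in> P" for B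
    using D(1) that by (auto simp: partition_on_def)
  have "\<Union>(?g ` P) = insert (Suc m) (\<Union>P)"
    using A'(1) by (auto simp: merge_def split: if_splits)
  then have "\<Union>(?g ` P) = {1..Suc m}"
    using D(8) by auto
  moreover have "disjoint (?g ` P)"
  proof (rule disjointI, clarify)
    fix B C assume BC: "B \<in> P" "C \<in> P" "?g B \<noteq> ?g C"
    then have "B \<noteq> C"
      by blast
    then have "B \<inter> C = {}"
      using D(1) BC by (auto simp: partition_on_def disjoint_def)
    moreover have "Suc m \<notin> B" "Suc m \<notin> C"
      using D(9) BC by auto
    ultimately show "?g B \<inter> ?g C = {}"
      using \<open>B \<noteq> C\<close> by (auto simp: merge_def)
  qed
  moreover have "{} \<notin> ?g ` P"
    using ne by (auto simp: merge_def)
  ultimately have "partition_on {1..Suc m} (?g ` P)"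
    by (simp add: partition_on_def)
  moreover have "rooted_tree (?g ` P) (?g R) (map_prod ?g ?g ` E)"
    using rooted_tree_relabel[OF D(3) M(2)] .
  moreover have "card (?g B) = 1 \<or> card (?g B) = 2" if "B \<in> P" for B
  proof (cases "B = A")
    case True
    have "finite A" "Suc m \<notin> A"
      using A' D(9) card_eq_0_iff[of A] by auto
    then show ?thesis
      using True A'(2) by (simp add: merge_def)
  next
    case False
    then show ?thesis
      using D(2)[OF that] by (simp add: merge_def)
  qed
  moreover have "a < b" if "(B, C) \<in> E" "a \<in> ?g B" "b \<in> ?g C" for B C a b
  proof -
    have "B \<noteq> A"
      using that A'(3) by blast
    then have a: "a \<in> B"
      using that by (simp add: merge_def)
    then have "a < Suc m"
      using that(1) D(5) D(10)[of B a] by auto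
    moreover have "b \<in> C \<or> b = Suc m"
      using that by (auto simp: merge_def split: if_splits)
    ultimately show ?thesis
      using D(4)[OF that(1) a] by blast
  qed
  ultimately show "merge_label (Suc m) ((P, R, E), A) \<in> uni_bilabelled_trees (Suc m)"
    by (auto simp: uni_bilabelled_trees_def merge_label_def)
  show "{Suc m} \<notin> ?g ` P"
    using M(1) ne by (metis Diff_cancel imageE)
qed

text \<open>Complements \<open>bij_betw_add_singleton\<close>: here \<open>Suc m\<close> shares its
  block. The inverse deletes \<open>Suc m\<close> from every block, and the block that shrinks is
  the node that had received it.\<close>

lemma bij_betw_merge_label:
  "bij_betw (merge_label (Suc m))
     (Sigma (uni_bilabelled_trees m) (\<lambda>(P, R, E). unilabelled_leaves P E))
     {t \<in> uni_bilabelled_trees (Suc m). {Suc m} \<notin> fst t}"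
    (is "bij_betw _ ?S ?R")
proof (rule bij_betw_imageI)
  let ?h = "\<lambda>B. B - {Suc m}"
  have inv: "?h ` merge (Suc m) A ` P = P" "?h (merge (Suc m) A R) = R"
      "map_prod ?h ?h ` map_prod (merge (Suc m) A) (merge (Suc m) A) ` E = E"
    if t: "(P, R, E) \<in> uni_bilabelled_trees m" and A: "A \<in> P" for P R E A
  proof -
    note M = merge_facts(1)[OF t A]
    have E: "E \<subseteq> P \<times> P" and R: "R \<in> P"
      using uni_bilabelled_treesD[OF t] by auto
    show "?h ` merge (Suc m) A ` P = P"
      unfolding image_image using M by simp
    show "?h (merge (Suc m) A R) = R"
      using M R .
    have "map_prod ?h ?h (map_prod (merge (Suc m) A) (merge (Suc m) A) e) = e" if "e \<in> E" for e
      using that E M by (cases e) auto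
    then show "map_prod ?h ?h ` map_prod (merge (Suc m) A) (merge (Suc m) A) ` E = E"
      unfolding image_image by simp
  qed
  show "inj_on (merge_label (Suc m)) ?S"
  proof (rule inj_onI, clarsimp simp: merge_label_def)
    fix P R E A P' R' E' A'
    assume t: "(P, R, E) \<in> uni_bilabelled_trees m" "(P', R', E') \<in> uni_bilabelled_trees m"
      and leaf: "A \<in> unilabelled_leaves P E" "A' \<in> unilabelled_leaves P' E'"
      and eq: "merge (Suc m) A ` P = merge (Suc m) A' ` P'"
        "merge (Suc m) A R = merge (Suc m) A' R'"
        "map_prod (merge (Suc m) A) (merge (Suc m) A) ` E =
         map_prod (merge (Suc m) A') (merge (Suc m) A') ` E'"
    have A: "A \<in> P" "A' \<in> P'"
      using leaf by (auto simp: unilabelled_leaves_def)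
    have "P = P'" "R = R'" "E = E'"
      using inv[OF t(1) A(1)] inv[OF t(2) A(2)] eq by simp_all
    \<comment> \<open>\<open>A\<close> is recovered as the node whose image contains
      \<open>Suc m\<close>.\<close>
    moreover have "A = A'"
    proof -
      obtain B where B: "B \<in> P'" "merge (Suc m) A A = merge (Suc m) A' B"
        using A eq(1) by (metis imageE imageI)
      then have "B = A'"
        using merge_facts(3)[OF t(1) A(1) A(1)] merge_facts(3)[OF t(2) A(2) B(1)] by simp
      then show ?thesis
        using B(2) merge_facts(1)[OF t(1) A(1) A(1)] merge_facts(1)[OF t(2) A(2) A(2)] by metis
    qed
    ultimately show "P = P' \<and> R = R' \<and> E = E' \<and> A = A'"
      by blast
  qed
  show "merge_label (Suc m) ` ?S = ?R"
  proof (intro equalityI subsetI)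
    fix t assume "t \<in> merge_label (Suc m) ` ?S"
    then obtain P R E A where "(P, R, E) \<in> uni_bilabelled_trees m" "A \<in> unilabelled_leaves P E"
      "t = merge_label (Suc m) ((P, R, E), A)"
      by auto
    then show "t \<in> ?R"
      using merge_label_in_trees[of P R E m A] by (simp add: merge_label_def)
  next
    fix t assume "t \<in> ?R"
    then obtain P R E where t: "t = (P, R, E)" and tree: "(P, R, E) \<in> uni_bilabelled_trees (Suc m)"
      and N: "{Suc m} \<notin> P"
      by (cases t) auto
    note D = uni_bilabelled_treesD[OF tree]
    \<comment> \<open>As \<open>{Suc m}\<close> is not a block, the deletion empties no block;
      together with disjointness this makes \<open>?h\<close> injective on \<open>P\<close>.\<close>
    have ne: "?h B \<noteq> {}" if "B \<in> P" for B
      using that N D(1) by (auto simp: partition_on_def subset_singleton_iff)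
    have disj: "B = C" if "B \<in> P" "C \<in> P" "B \<inter> C \<noteq> {}" for B C
      using that D(1) by (auto simp: partition_on_def disjoint_def)
    have inj: "B = C" if "B \<in> P" "C \<in> P" "?h B \<inter> ?h C \<noteq> {}" for B C
      using disj[OF that(1,2)] that(3) by blast
    have inj_h: "inj_on ?h P"
    proof (rule inj_onI)
      fix B C assume BC: "B \<in> P" "C \<in> P" "?h B = ?h C"
      then have "?h B \<inter> ?h C \<noteq> {}"
        using ne by simp
      then show "B = C"
        by (rule inj[OF BC(1,2)])
    qed
    have "\<Union>(?h ` P) = \<Union>P - {Suc m}"
      by blast
    then have "\<Union>(?h ` P) = {1..m}"
      using D(8) by auto
    moreover have "disjoint (?h ` P)"
    proof (rule disjointI, clarify)
      fix B C assume "B \<in> P" "C \<in> P" "?h B \<noteq> ?h C"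
      then show "?h B \<inter> ?h C = {}"
        using inj[of B C] by blast
    qed
    ultimately have part: "partition_on {1..m} (?h ` P)"
      using ne by (auto simp: partition_on_def)
    have finP: "finite B" if "B \<in> P" for B
      using D(2)[OF that] card_eq_0_iff[of B] by auto
    have cards: "card (?h B) = 1 \<or> card (?h B) = 2" if "B \<in> P" for B
    proof -
      have "card (?h B) \<le> card B" "card (?h B) \<noteq> 0"
        using ne[OF that] finP[OF that] by (auto intro: card_mono)
      then show ?thesis
        using D(2)[OF that] by linarith
    qed
    let ?t = "(?h ` P, ?h R, map_prod ?h ?h ` E)"
    have tree': "?t \<in> uni_bilabelled_trees m"
      using part cards rooted_tree_relabel[OF D(3) inj_h] D(4)
      by (auto simp: uni_bilabelled_trees_def)
    \<comment> \<open>The block \<open>X\<close> holding \<open>Suc m\<close> has two labels; its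
      remainder \<open>?h X\<close> is the unilabelled leaf to be enlarged.\<close>
    have "Suc m \<in> \<Union>P"
      using D(8) by simp
    then obtain X where X: "X \<in> P" "Suc m \<in> X"
      by blast
    have "card (?h X) = 1"
      using cards[OF X(1)] D(2)[OF X(1)] X(2) finP[OF X(1)] by (auto simp: card_Diff_singleton)
    moreover have "?h X \<notin> Domain (map_prod ?h ?h ` E)"
    proof
      assume "?h X \<in> Domain (map_prod ?h ?h ` E)"
      then obtain B C where B: "(B, C) \<in> E" "?h B = ?h X"
        by auto
      then have "B = X"
        using inj_h D(5) X(1) by (auto dest: inj_onD)
      then show False
        using B max_label_leaf[OF tree X(2)] by blast
    qed
    ultimately have leaf: "?h X \<in> unilabelled_leaves (?h ` P) (map_prod ?h ?h ` E)"
      using X(1) by (simp add: unilabelled_leaves_def)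
    let ?g = "merge (Suc m) (?h X)"
    have g: "?g (?h B) = B" if "B \<in> P" for B
    proof (cases "B = X")
      case True
      then show ?thesis
        using X(2) by (auto simp: merge_def)
    next
      case False
      then have "?h B \<noteq> ?h X" "Suc m \<notin> B"
        using that X inj_h disj[OF that X(1)] by (auto dest: inj_onD)
      then show ?thesis
        by (simp add: merge_def)
    qed
    have "?g ` ?h ` P = P" "?g (?h R) = R"
      unfolding image_image using g D(6) by simp_all
    moreover have "map_prod ?g ?g (map_prod ?h ?h e) = e" if "e \<in> E" for e
      using that D(5) g by (cases e) auto
    then have "map_prod ?g ?g ` map_prod ?h ?h ` E = E"
      unfolding image_image by simp
    ultimately have "t = merge_label (Suc m) (?t, ?h X)"
      by (simp add: merge_label_def t)
    then show "t \<in> merge_label (Suc m) ` ?S"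
      using tree' leaf by (intro image_eqI) auto
  qed
qed

text \<open>A new leaf below one of the \<open>i\<close> other nodes raises \<open>j\<close>. A new
  leaf below a unilabelled leaf takes over its role, while the old one joins the \<open>i\<close>
  nodes. A second label moves a unilabelled leaf there without replacement.\<close>

lemma sum_uni_bilabelled_trees_Suc:
  fixes \<phi> :: "nat \<Rightarrow> nat \<Rightarrow> nat"
  assumes "m \<ge> 1"
  shows "(\<Sum>(P, R, E)\<in>uni_bilabelled_trees (Suc m).
            \<phi> (card (P - unilabelled_leaves P E)) (card (unilabelled_leaves P E)))
       = (\<Sum>(P, R, E)\<in>uni_bilabelled_trees m.
            let i = card (P - unilabelled_leaves P E); j = card (unilabelled_leaves P E)
            in i * \<phi> i (j + 1) + j * (\<phi> (i + 1) j + \<phi> (i + 1) (j - 1)))"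
    (is "?lhs = ?rhs")
proof -
  let ?T = "uni_bilabelled_trees (Suc m)"
  define \<psi> where "\<psi> = (\<lambda>(P, R :: nat set, E).
    \<phi> (card (P - unilabelled_leaves P E)) (card (unilabelled_leaves P E)))"
  have fin_tree: "finite (fst t)" if "t \<in> uni_bilabelled_trees m" for t
    using that uni_bilabelled_treesD(7) by (cases t) auto
  have fin_leaves: "finite (unilabelled_leaves P E)" if "finite P" for P E
    using that by (simp add: unilabelled_leaves_def)
  have "?lhs = sum \<psi> ?T"
    by (simp add: \<psi>_def)
  also have "\<dots> = sum \<psi> {t \<in> ?T. {Suc m} \<in> fst t} + sum \<psi> {t \<in> ?T. {Suc m} \<notin> fst t}"
    using finite_uni_bilabelled_trees
    by (subst sum.union_disjoint[symmetric]) (auto intro: sum.cong)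
  also have "sum \<psi> {t \<in> ?T. {Suc m} \<in> fst t}
      = (\<Sum>x\<in>Sigma (uni_bilabelled_trees m) fst. \<psi> (add_singleton (Suc m) x))"
    by (rule sum.reindex_bij_betw[OF bij_betw_add_singleton[OF assms], symmetric])
  also have "\<dots> = (\<Sum>t\<in>uni_bilabelled_trees m. \<Sum>A\<in>fst t. \<psi> (add_singleton (Suc m) (t, A)))"
    using fin_tree finite_uni_bilabelled_trees by (subst sum.Sigma) auto
  also have "sum \<psi> {t \<in> ?T. {Suc m} \<notin> fst t}
      = (\<Sum>x\<in>Sigma (uni_bilabelled_trees m) (\<lambda>(P, R, E). unilabelled_leaves P E).
           \<psi> (merge_label (Suc m) x))"
    by (rule sum.reindex_bij_betw[OF bij_betw_merge_label, symmetric])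
  also have "\<dots> = (\<Sum>t\<in>uni_bilabelled_trees m.
      \<Sum>A\<in>(case t of (P, R, E) \<Rightarrow> unilabelled_leaves P E). \<psi> (merge_label (Suc m) (t, A)))"
    using fin_tree fin_leaves finite_uni_bilabelled_trees by (subst sum.Sigma) fastforce+
  also have "(\<Sum>t\<in>uni_bilabelled_trees m. \<Sum>A\<in>fst t. \<psi> (add_singleton (Suc m) (t, A))) + \<dots> = ?rhs"
    unfolding sum.distrib[symmetric]
  proof (rule sum.cong[OF refl], clarify)
    fix P R E assume t: "(P, R, E) \<in> uni_bilabelled_trees m"
    note D = uni_bilabelled_treesD[OF t]
    let ?L = "unilabelled_leaves P E" and ?N = "{Suc m}"
    have fin: "finite P" "finite ?L" and sub: "?L \<subseteq> P"
      using D(7) by (auto simp: unilabelled_leaves_def)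
    have N: "?N \<notin> P"
      using D(9) by blast
    have add: "\<psi> (add_singleton (Suc m) ((P, R, E), A)) =
        (if A \<in> ?L then \<phi> (card (P - ?L) + 1) (card ?L) else \<phi> (card (P - ?L)) (card ?L + 1))"
      if A: "A \<in> P" for A
    proof -
      have "?N \<notin> Domain E" "?N \<noteq> A"
        using D(5) N A by blast+
      \<comment> \<open>The new node is a unilabelled leaf and \<open>A\<close>, now a parent, is
        none; if \<open>A\<close> was none before, removing it changes nothing.\<close>
      then have L': "unilabelled_leaves (insert ?N P) (insert (A, ?N) E) = insert ?N (?L - {A})"
        by (auto simp: unilabelled_leaves_def)
      have "?N \<notin> ?L"
        using N sub by blast
      show ?thesis
      proof (cases "A \<in> ?L")
        case True
        then have "insert ?N P - insert ?N (?L - {A}) = insert A (P - ?L)"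
          using A N by blast
        moreover have "card ?L > 0"
          using True fin by (auto simp: card_gt_0_iff)
        ultimately show ?thesis
          using True fin \<open>?N \<notin> ?L\<close> by (simp add: \<psi>_def add_singleton_def L' card_Diff_singleton)
      next
        case False
        then have "insert ?N P - insert ?N (?L - {A}) = P - ?L" "?L - {A} = ?L"
          using N by blast+
        then show ?thesis
          using False fin \<open>?N \<notin> ?L\<close> by (simp add: \<psi>_def add_singleton_def L')
      qed
    qed
    have mrg: "\<psi> (merge_label (Suc m) ((P, R, E), A)) = \<phi> (card (P - ?L) + 1) (card ?L - 1)"
      if A: "A \<in> ?L" for A
    proof -
      let ?g = "merge (Suc m) A"
      have A': "A \<in> P" "card A = 1"
        using A by (auto simp: unilabelled_leaves_def)
      note M = merge_facts[OF t A'(1)]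
      have dom: "?g B \<in> Domain (map_prod ?g ?g ` E) \<longleftrightarrow> B \<in> Domain E" if "B \<in> P" for B
      proof
        assume "?g B \<in> Domain (map_prod ?g ?g ` E)"
        then obtain C C' where C: "(C, C') \<in> E" "?g B = ?g C"
          by auto
        then have "B = C"
          using inj_onD[OF M(2) C(2) that] D(5) by blast
        then show "B \<in> Domain E"
          using C(1) by blast
      next
        assume "B \<in> Domain E"
        then obtain C where "(B, C) \<in> E"
          by blast
        then have "(?g B, ?g C) \<in> map_prod ?g ?g ` E"
          by (intro image_eqI[of _ _ "(B, C)"]) simp_all
        then show "?g B \<in> Domain (map_prod ?g ?g ` E)"
          by (rule DomainI)
      qed
      have card1: "card (?g B) = 1 \<longleftrightarrow> card B = 1 \<and> B \<noteq> A" if "B \<in> P" for B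
      proof -
        have "finite A"
          using A'(2) card_eq_0_iff[of A] by auto
        then show ?thesis
          using A' D(9)[OF A'(1)] by (simp add: merge_def)
      qed
      have mem: "?g B \<in> unilabelled_leaves (?g ` P) (map_prod ?g ?g ` E) \<longleftrightarrow> B \<in> ?L - {A}"
        if "B \<in> P" for B
        unfolding unilabelled_leaves_def mem_Collect_eq dom[OF that] card1[OF that]
        using that by blast
      have L': "unilabelled_leaves (?g ` P) (map_prod ?g ?g ` E) = ?g ` (?L - {A})"
      proof (intro equalityI subsetI)
        fix X assume X: "X \<in> unilabelled_leaves (?g ` P) (map_prod ?g ?g ` E)"
        then have "X \<in> ?g ` P"
          by (simp add: unilabelled_leaves_def)
        then obtain B where B: "B \<in> P" "X = ?g B"
          by (rule imageE)
        then show "X \<in> ?g ` (?L - {A})"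
          using X mem[OF B(1)] by simp
      next
        fix X assume "X \<in> ?g ` (?L - {A})"
        then obtain B where B: "B \<in> ?L - {A}" "X = ?g B"
          by (rule imageE)
        then have "B \<in> P"
          using sub by (simp add: subset_eq)
        then show "X \<in> unilabelled_leaves (?g ` P) (map_prod ?g ?g ` E)"
          using B mem by simp
      qed
      have "?g ` P - ?g ` (?L - {A}) = ?g ` (P - (?L - {A}))"
        using M(2) sub by (intro inj_on_image_set_diff[symmetric]) auto
      moreover have "P - (?L - {A}) = insert A (P - ?L)"
        using A'(1) by blast
      ultimately have "card (?g ` P - ?g ` (?L - {A})) = card (insert A (P - ?L))"
        using M(2) A'(1) by (metis Diff_subset card_image inj_on_subset)
      moreover have "card (?g ` (?L - {A})) = card (?L - {A})"
        using M(2) sub by (intro card_image) (auto intro: inj_on_subset)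
      ultimately show ?thesis
        using A fin by (simp add: \<psi>_def merge_label_def L' card_Diff_singleton)
    qed
    have "(\<Sum>A\<in>P. \<psi> (add_singleton (Suc m) ((P, R, E), A))) =
        (\<Sum>A\<in>P - ?L. \<psi> (add_singleton (Suc m) ((P, R, E), A))) +
        (\<Sum>A\<in>?L. \<psi> (add_singleton (Suc m) ((P, R, E), A)))"
      using fin sub by (simp add: sum.subset_diff)
    also have "\<dots> = card (P - ?L) * \<phi> (card (P - ?L)) (card ?L + 1)
        + card ?L * \<phi> (card (P - ?L) + 1) (card ?L)"
      using add sub by (simp add: subset_eq)
    finally show "(\<Sum>A\<in>fst (P, R, E). \<psi> (add_singleton (Suc m) ((P, R, E), A))) +
        (\<Sum>A\<in>?L. \<psi> (merge_label (Suc m) ((P, R, E), A))) =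
        (let i = card (P - ?L); j = card ?L
         in i * \<phi> i (j + 1) + j * (\<phi> (i + 1) j + \<phi> (i + 1) (j - 1)))"
      using mrg by (simp add: Let_def algebra_simps)
  qed
  finally show ?thesis .
qed

section \<open>The two growth grammars\<close>

text \<open>
  \<open>uni_bi_count n i j\<close> is the value of \<open>D\<^sup>n (x\<^sup>i y\<^sup>j)\<close> at \<open>x = y = 1\<close>, and \<open>coloured_count n p q b\<close>
  that of \<open>D\<^sup>n (u\<^sup>p v\<^sup>q w\<^sup>b)\<close> at \<open>u = v = w = 1\<close>.
\<close>

fun uni_bi_count :: "nat \<Rightarrow> nat \<Rightarrow> nat \<Rightarrow> nat" where
  "uni_bi_count 0 i j = 1"
| "uni_bi_count (Suc n) i j = i * uni_bi_count n i (j + 1)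
     + j * (uni_bi_count n (i + 1) j + uni_bi_count n (i + 1) (j - 1))"

fun coloured_count :: "nat \<Rightarrow> nat \<Rightarrow> nat \<Rightarrow> nat \<Rightarrow> nat" where
  "coloured_count 0 p q b = 1"
| "coloured_count (Suc n) p q b = p * coloured_count n p (q + 1) b
     + 2 * q * coloured_count n (p + 1) (q - 1) (b + 1) + b * coloured_count n (p + 1) q b"

text \<open>Since \<open>D\<close> annihilates \<open>v + 1 - 2 w\<close>, it commutes with
  multiplication by this factor, which vanishes at \<open>u = v = w = 1\<close>. The induction
  verifies this term by term: 1, 2, 3 are the contributions of \<open>D\<close> acting on the powers
  of \<open>u\<close>, \<open>v\<close>, \<open>w\<close>.\<close>

lemma coloured_count_relation:
  "coloured_count n p (q + 1) b + coloured_count n p q b = 2 * coloured_count n p q (b + 1)"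
proof (induction n arbitrary: p q b)
  case (Suc n)
  have 1: "coloured_count n p (q + 2) b + coloured_count n p (q + 1) b
      = 2 * coloured_count n p (q + 1) (b + 1)"
    using Suc[of p "q + 1" b] by simp
  \<comment> \<open>For \<open>q = 0\<close> the truncated \<open>q - 1\<close> is harmless thanks
    to the factor \<open>q\<close>.\<close>
  have 2: "q * coloured_count n (p + 1) q (b + 1) + q * coloured_count n (p + 1) (q - 1) (b + 1)
      = 2 * q * coloured_count n (p + 1) (q - 1) (b + 2)"
  proof (cases q)
    case (Suc q')
    then show ?thesis
      using arg_cong[OF Suc.IH[of "p + 1" q' "b + 1"], of "\<lambda>x. q * x"] by (simp add: algebra_simps)
  qed simp
  note 3 = Suc[of "p + 1" q b]
  \<comment> \<open>Beyond 1, 2 and 3, each side retains one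
    \<open>2 * coloured_count n (p + 1) q (b + 1)\<close>, from \<open>D v\<close> on the left and
    from \<open>D (2 w)\<close> on the right.\<close>
  show ?case
    using arg_cong[OF 1, of "\<lambda>x. p * x"] 2 arg_cong[OF 3, of "\<lambda>x. b * x"]
    by (simp add: algebra_simps)
qed simp

text \<open>Without a factor \<open>w\<close> the two rules differ only in
  \<open>D y = x y + x\<close> against \<open>D v = 2 u w\<close>, which
  \<open>coloured_count_relation\<close> reconciles.\<close>

lemma uni_bi_count_eq_coloured_count: "uni_bi_count n i j = coloured_count n i j 0"
proof (induction n arbitrary: i j)
  case (Suc n)
  have "j * (coloured_count n (i + 1) j 0 + coloured_count n (i + 1) (j - 1) 0)
      = 2 * j * coloured_count n (i + 1) (j - 1) 1"
    using coloured_count_relation[of n "i + 1" "j - 1" 0] by (cases j) simp_all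
  then show ?case
    by (simp add: Suc)
qed simp

text \<open>Each induction step trades one node for one application of \<open>D\<close>, hence the
  general \<open>n\<close>, until only the one-node tree \<open>u\<close> remains. The factor
  \<open>2 ^ card (branching_nodes j E)\<close> counts colourings and supplies the coefficient in
  \<open>D v = 2 u w\<close>.\<close>

lemma sum_coloured_count:
  assumes "j \<ge> 1"
  shows "(\<Sum>(r, E)\<in>increasing_trees j. 2 ^ card (branching_nodes j E) *
            coloured_count n (card (leaves j E)) (card (unary_nodes j E)) (card (branching_nodes j E)))
       = coloured_count (j - 1 + n) 1 0 0"
  using assms
proof (induction j arbitrary: n rule: dec_induct)
  case base
  have "leaves 1 {} = {1}" "unary_nodes 1 {} = {}" "branching_nodes 1 {} = {}"
    by (auto simp: degree_class_defs out_degree_def)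
  then show ?case
    unfolding increasing_trees_1 by simp
next
  case (step j)
  show ?case
    using step.IH[of "Suc n"] step.hyps
      sum_increasing_trees_Suc[of j "\<lambda>p q b. 2 ^ b * coloured_count n p q b"]
    by (simp add: Let_def algebra_simps)
qed

text \<open>The same exchange; the one-node tree is a single unilabelled leaf, so the arguments
  \<open>0 1\<close> stand for the monomial \<open>y\<close>.\<close>

lemma sum_uni_bi_count:
  assumes "m \<ge> 1"
  shows "(\<Sum>(P, R, E)\<in>uni_bilabelled_trees m.
            uni_bi_count n (card (P - unilabelled_leaves P E)) (card (unilabelled_leaves P E)))
       = uni_bi_count (m - 1 + n) 0 1"
  using assms
proof (induction m arbitrary: n rule: dec_induct)
  case base
  have "unilabelled_leaves {{1}} {} = {{1}}"
    by (auto simp: unilabelled_leaves_def)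
  then show ?case
    unfolding uni_bilabelled_trees_1 by simp
next
  case (step m)
  show ?case
    using step.IH[of "Suc n"] step.hyps sum_uni_bilabelled_trees_Suc[of m "uni_bi_count n"]
    by (simp add: Let_def)
qed

section \<open>Comparison of the two cardinalities\<close>

lemma card_uni_bilabelled_trees:
  assumes "m \<ge> 1"
  shows "card (uni_bilabelled_trees m) = uni_bi_count (m - 1) 0 1"
  using sum_uni_bi_count[OF assms, of 0] by simp

lemma card_coloured_trees_eq_count:
  assumes "j \<ge> 1"
  shows "card (coloured_trees j) = uni_bi_count (j - 1) 1 0"
  using sum_coloured_count[OF assms, of 0]
  by (simp add: card_coloured_trees uni_bi_count_eq_coloured_count)

theorem theorem8p3:
  fixes m :: nat
  assumes "m \<ge> 1"
  shows "\<exists>f. bij_betw f (uni_bilabelled_trees m) (coloured_trees m <+> coloured_trees (m - 1))"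
proof (rule finite_same_card_bij)
  show "finite (uni_bilabelled_trees m)"
    by (rule finite_uni_bilabelled_trees)
  show "finite (coloured_trees m <+> coloured_trees (m - 1))"
    using finite_coloured_trees by simp
  have "card (uni_bilabelled_trees m) = card (coloured_trees m) + card (coloured_trees (m - 1))"
  proof (cases "m = 1")
    \<comment> \<open>Here the second summand is \<open>coloured_trees 0\<close>, outside the range
      of the counting formula but empty.\<close>
    case True
    then show ?thesis
      using card_uni_bilabelled_trees[of 1] card_coloured_trees_eq_count[of 1]
      by (simp add: coloured_trees_0)
  next
    case False
    \<comment> \<open>Now \<open>D y = x y + x = D x + x\<close> gives
      \<open>D^(n+1) y = D^(n+1) x + D^n x\<close>; the two summands count the coloured trees with
      \<open>m\<close> and with \<open>m - 1\<close> nodes.\<close>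
    then obtain n where "m = Suc (Suc n)"
      using assms by (metis One_nat_def Suc_le_D not0_implies_Suc)
    then show ?thesis
      using card_uni_bilabelled_trees[of m] card_coloured_trees_eq_count[of m]
        card_coloured_trees_eq_count[of "m - 1"]
      by simp
  qed
  then show "card (uni_bilabelled_trees m) = card (coloured_trees m <+> coloured_trees (m - 1))"
    using finite_coloured_trees by (simp add: card_Plus)
qed

end
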